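(* Let $T$ be a stratified real algebraic variety with finite stratification $L$ and marked point $e\in F\in L$. Let $n\in\mathbb N\cup\{\infty\}$ be such that $T^{(m)}$ is a real algebraic variety for each $m\le n$ (each finite $m$ if $n=\infty$). Then there exists an isomorphism of filtered digraphs $$\tau_n:\ Adj((T,L))^{(n)}\to Adj\big(T^{(n)},L^{(n)}\big).$$
   Context: A stratified real algebraic variety is a real algebraic variety with a partition into (non-empty) semialgebraic sets called strata. $T^{(m)}=T^m/\Sigma_m$ is the $m$-th symmetric product (multisets of cardinality $m$), stratified by $L^{(m)}$: a stratum is the set of multisets with a prescribed number of points (with multiplicity) in each stratum of $L$. The $T^{(m)}$, $m\le n$, form a filtered stratified variety by the embeddings $T^{(m)}\to T^{(m+1)}$ adding the point $e$ to a multiset. The adjacency digraph $Adj$ of a finitely stratified variety has the strata as vertices and an edge $(A,B)$ iff $\overline A\cap B\neq\varnothing$ (Euclidean closure); for a filtered stratified variety, $Adj$ is the sequence of adjacency digraphs of its levels, with maps sending a stratum $s$ to the stratum of the next level containing the image of $s$. A filtered digraph is a sequence of embeddings of digraphs $G_0\to G_1\to\cdots$. For a digraph $G$, $G^m$ has $m$-tuples of vertices as vertices and an edge iff there is an edge in every component; $G^{(m)}$ is its quotient by $\Sigma_m$ (vertices are multisets of $m$ vertices; there is an edge between two multisets iff some orderings of them form an edge of $G^m$). For $G=Adj((T,L))$ with marked vertex $F$, $G^{(n)}$ on the left denotes the filtered digraph of the $G^{(m)}$, $m\le n$, with embeddings adding $F$ to a multiset; on the right, $Adj(T^{(n)},L^{(n)})$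 denotes the filtered digraph of the $Adj(T^{(m)},L^{(m)})$, $m\le n$. An isomorphism of filtered digraphs is a sequence of digraph isomorphisms commuting with the embeddings. *)

theory Defs
  imports
    "HOL-Analysis.Analysis"
    "HOL-Library.Multiset"
    "HOL-Library.Extended_Nat"
    "HOL-Library.Disjoint_Sets"
    "Graph_Theory.Graph_Theory"
begin

section \<open>Real algebraic varieties\<close>

text \<open>
  The algebra of real functions generated by a set of functions. Multivariate polynomial
  functions are the special case of the coordinate functions.
\<close>

inductive_set fun_algebra :: "('a \<Rightarrow> real) set \<Rightarrow> ('a \<Rightarrow> real) set" for F where
  const: "(\<lambda>_. c) \<in> fun_algebra F"
| gen: "f \<in> F \<Longrightarrow> f \<in> fun_algebra F"
| add: "f \<in> fun_algebra F \<Longrightarrow> g \<in> fun_algebra F \<Longrightarrow> (\<lambda>x. f x + g x) \<in> fun_algebra F"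
| mult: "f \<in> fun_algebra F \<Longrightarrow> g \<in> fun_algebra F \<Longrightarrow> (\<lambda>x. f x * g x) \<in> fun_algebra F"

text \<open>
  The dimension \<open>k\<close> of the affine space must be allowed to vary inside formulas, so its points
  are the extensional functions on \<open>{..<k}\<close>.
\<close>

definition affine_space :: "nat \<Rightarrow> (nat \<Rightarrow> real) set" where
  "affine_space k = {..<k} \<rightarrow>\<^sub>E UNIV"

definition polys :: "nat \<Rightarrow> ((nat \<Rightarrow> real) \<Rightarrow> real) set" where
  "polys k = fun_algebra {\<lambda>x. x i | i. i < k}"

definition algebraic_set :: "nat \<Rightarrow> (nat \<Rightarrow> real) set \<Rightarrow> bool" where
  "algebraic_set k V \<longleftrightarrow> (\<exists>P \<subseteq> polys k. V = {x \<in> affine_space k. \<forall>p\<in>P. p x = 0})"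

inductive_set semialgebraic :: "nat \<Rightarrow> (nat \<Rightarrow> real) set set" for k where
  pos: "p \<in> polys k \<Longrightarrow> {x \<in> affine_space k. p x > 0} \<in> semialgebraic k"
| compl: "S \<in> semialgebraic k \<Longrightarrow> affine_space k - S \<in> semialgebraic k"
| inter: "S \<in> semialgebraic k \<Longrightarrow> S' \<in> semialgebraic k \<Longrightarrow> S \<inter> S' \<in> semialgebraic k"
| union: "S \<in> semialgebraic k \<Longrightarrow> S' \<in> semialgebraic k \<Longrightarrow> S \<union> S' \<in> semialgebraic k"

text \<open>
  A space with a Zariski topology and, for every open set, the real functions regular on it.
  Regular functions on \<open>U\<close> are represented by total functions of which only the values on \<open>U\<close>
  matter; \<open>reg X U\<close> has no meaning if \<open>U\<close> is not open.
\<close>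

record 'a fun_space =
  zar :: "'a topology"
  reg :: "'a set \<Rightarrow> ('a \<Rightarrow> real) set"

definition points :: "'a fun_space \<Rightarrow> 'a set" where
  "points X = topspace (zar X)"

definition sheaf_of_functions :: "'a fun_space \<Rightarrow> bool" where
  "sheaf_of_functions X \<longleftrightarrow>
     (\<forall>U f g. openin (zar X) U \<longrightarrow> f \<in> reg X U \<longrightarrow> (\<forall>x\<in>U. f x = g x) \<longrightarrow> g \<in> reg X U) \<and>
     (\<forall>U V f. openin (zar X) U \<longrightarrow> openin (zar X) V \<longrightarrow> V \<subseteq> U \<longrightarrow> f \<in> reg X U \<longrightarrow> f \<in> reg X V) \<and>
     (\<forall>U f. openin (zar X) U \<longrightarrow>
        (\<forall>x\<in>U. \<exists>V. openin (zar X) V \<and> x \<in> V \<and> V \<subseteq> U \<and> f \<in> reg X V) \<longrightarrow> f \<in> reg X U)"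

definition open_subspace :: "'a fun_space \<Rightarrow> 'a set \<Rightarrow> 'a fun_space" where
  "open_subspace X U = \<lparr>zar = subtopology (zar X) U, reg = reg X\<rparr>"

definition regular_map :: "'a fun_space \<Rightarrow> 'b fun_space \<Rightarrow> ('a \<Rightarrow> 'b) \<Rightarrow> bool" where
  "regular_map X Y h \<longleftrightarrow> continuous_map (zar X) (zar Y) h \<and>
     (\<forall>W. openin (zar Y) W \<longrightarrow>
        (\<forall>f \<in> reg Y W. (\<lambda>x. f (h x)) \<in> reg X {x \<in> points X. h x \<in> W}))"

definition biregular_map :: "'a fun_space \<Rightarrow> 'b fun_space \<Rightarrow> ('a \<Rightarrow> 'b) \<Rightarrow> bool" where
  "biregular_map X Y h \<longleftrightarrow> homeomorphic_map (zar X) (zar Y) h \<and>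
     (\<forall>W. openin (zar Y) W \<longrightarrow>
        (\<forall>f. f \<in> reg Y W \<longleftrightarrow> (\<lambda>x. f (h x)) \<in> reg X {x \<in> points X. h x \<in> W}))"

text \<open>
  The Zariski topology and the regular functions of an algebraic set: a function is regular on
  \<open>W\<close> if near every point of \<open>W\<close> it is a quotient of polynomials. It suffices to consider the
  neighbourhoods on which the denominator does not vanish, because sets of this form are a basis
  of the Zariski topology.
\<close>

definition algebraic_set_space :: "nat \<Rightarrow> (nat \<Rightarrow> real) set \<Rightarrow> (nat \<Rightarrow> real) fun_space" where
  "algebraic_set_space k V = \<lparr>
     zar = topology_generated_by {{x \<in> V. q x \<noteq> 0} | q. q \<in> polys k},
     reg = (\<lambda>W. {f. \<forall>x\<in>W. \<exists>p\<in>polys k. \<exists>q\<in>polys k.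
              q x \<noteq> 0 \<and> (\<forall>y\<in>W. q y \<noteq> 0 \<longrightarrow> f y = p y / q y)})\<rparr>"

definition affine_chart ::
    "'a fun_space \<Rightarrow> 'a set \<Rightarrow> nat \<Rightarrow> (nat \<Rightarrow> real) set \<Rightarrow> ('a \<Rightarrow> nat \<Rightarrow> real) \<Rightarrow> bool" where
  "affine_chart X U k V h \<longleftrightarrow> openin (zar X) U \<and> algebraic_set k V \<and>
     biregular_map (open_subspace X U) (algebraic_set_space k V) h"

definition real_algebraic_variety :: "'a fun_space \<Rightarrow> bool" where
  "real_algebraic_variety X \<longleftrightarrow> sheaf_of_functions X \<and>
     (\<exists>\<U>. finite \<U> \<and> \<Union>\<U> = points X \<and> (\<forall>U\<in>\<U>. \<exists>k V h. affine_chart X U k V h))"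

definition semialgebraic_in :: "'a fun_space \<Rightarrow> 'a set \<Rightarrow> bool" where
  "semialgebraic_in X S \<longleftrightarrow> S \<subseteq> points X \<and>
     (\<forall>U k V h. affine_chart X U k V h \<longrightarrow> h ` (S \<inter> U) \<in> semialgebraic k)"

text \<open>
  The Euclidean topology is the coarsest one in which Zariski open sets are open and regular
  functions on them are continuous. On an algebraic set in \<open>\<real>\<^sup>k\<close> this is the topology
  induced from \<open>\<real>\<^sup>k\<close>, since the coordinates are regular functions.
\<close>

definition euclidean_topology :: "'a fun_space \<Rightarrow> 'a topology" where
  "euclidean_topology X = topology_generated_by
     {{x \<in> U. f x \<in> S} | U f S. openin (zar X) U \<and> f \<in> reg X U \<and> open S}"

definition stratified_variety :: "'a fun_space \<Rightarrow> 'a set set \<Rightarrow> bool" where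
  "stratified_variety X L \<longleftrightarrow> real_algebraic_variety X \<and> partition_on (points X) L \<and>
     (\<forall>A\<in>L. semialgebraic_in X A)"


section \<open>Symmetric products\<close>

text \<open>
  Multisets of cardinality \<open>m\<close> are the orbits of \<open>m\<close>-tuples under permutations;
  \<open>tuple_mset m\<close> is the quotient map.
\<close>

definition multisets :: "'a set \<Rightarrow> nat \<Rightarrow> 'a multiset set" where
  "multisets A m = {M. set_mset M \<subseteq> A \<and> size M = m}"

definition tuple_mset :: "nat \<Rightarrow> (nat \<Rightarrow> 'a) \<Rightarrow> 'a multiset" where
  "tuple_mset m x = image_mset x (mset_set {..<m})"

text \<open>
  The \<open>m\<close>-fold product of a variety. The functions in \<open>product_funs m X U\<close> are polynomials in
  functions that are regular on the factors of a box \<open>U 0 \<times> \<dots> \<times> U (m - 1)\<close> of Zariski open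
  sets. Their nonvanishing loci form a basis of the Zariski topology of the product, and regular
  functions are locally quotients of them.
\<close>

definition product_funs ::
    "nat \<Rightarrow> 'a fun_space \<Rightarrow> (nat \<Rightarrow> 'a set) \<Rightarrow> ((nat \<Rightarrow> 'a) \<Rightarrow> real) set" where
  "product_funs m X U = fun_algebra {\<lambda>x. g (x i) | g i. i < m \<and> g \<in> reg X (U i)}"

definition power_space :: "nat \<Rightarrow> 'a fun_space \<Rightarrow> (nat \<Rightarrow> 'a) fun_space" where
  "power_space m X = \<lparr>
     zar = topology_generated_by {{x \<in> {..<m} \<rightarrow>\<^sub>E points X. (\<forall>i<m. x i \<in> U i) \<and> q x \<noteq> 0} | U q.
             (\<forall>i<m. openin (zar X) (U i)) \<and> q \<in> product_funs m X U},
     reg = (\<lambda>W. {f. \<forall>x\<in>W. \<exists>U. (\<forall>i<m. openin (zar X) (U i) \<and> x i \<in> U i) \<and>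
             (\<exists>p\<in>product_funs m X U. \<exists>q\<in>product_funs m X U. q x \<noteq> 0 \<and>
                (\<forall>y\<in>W. (\<forall>i<m. y i \<in> U i) \<longrightarrow> q y \<noteq> 0 \<longrightarrow> f y = p y / q y))})\<rparr>"

text \<open>
  \<open>Y\<close> is a structure of real algebraic variety on the quotient of the \<open>m\<close>-th power of \<open>X\<close>:
  the quotient map is regular, and the Euclidean topology of \<open>Y\<close> is the quotient topology. The
  regular functions on \<open>Y\<close> are not required to be all symmetric regular functions: with
  that requirement the symmetric products of the complex line, which are complex affine
  spaces, would be excluded.
\<close>

definition symmetric_product_variety :: "nat \<Rightarrow> 'a fun_space \<Rightarrow> 'a multiset fun_space \<Rightarrow> bool" where
  "symmetric_product_variety m X Y \<longleftrightarrow> real_algebraic_variety Y \<and>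
     points Y = multisets (points X) m \<and>
     regular_map (power_space m X) Y (tuple_mset m) \<and>
     quotient_map (euclidean_topology (power_space m X)) (euclidean_topology Y) (tuple_mset m)"

definition symmetric_strata :: "'a set set \<Rightarrow> nat \<Rightarrow> 'a multiset set set" where
  "symmetric_strata L m =
     {{M \<in> multisets (\<Union>L) m. \<forall>A\<in>L. size {#x \<in># M. x \<in> A#} = c A} | c. (\<Sum>A\<in>L. c A) = m}"


section \<open>Filtered digraphs\<close>

definition digraph_embedding ::
    "'v pair_pre_digraph \<Rightarrow> 'w pair_pre_digraph \<Rightarrow> ('v \<Rightarrow> 'w) \<Rightarrow> bool" where
  "digraph_embedding G H h \<longleftrightarrow> inj_on h (pverts G) \<and> h ` pverts G \<subseteq> pverts H \<and>
     (\<forall>(u, v)\<in>parcs G. (h u, h v) \<in> parcs H)"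

text \<open>Without parallel arcs, an isomorphism is determined by its action on vertices.\<close>

definition digraph_isomorphic_via ::
    "'v pair_pre_digraph \<Rightarrow> 'w pair_pre_digraph \<Rightarrow> ('v \<Rightarrow> 'w) \<Rightarrow> bool" where
  "digraph_isomorphic_via G H h \<longleftrightarrow>
     (let hom = \<lparr>iso_verts = h, iso_arcs = map_prod h h, iso_head = snd, iso_tail = fst\<rparr>
      in pre_digraph.digraph_isomorphism (with_proj G) hom \<and>
         with_proj H = app_iso hom (with_proj G))"

text \<open>\<open>step G m\<close> is the embedding of level \<open>m\<close> into level \<open>Suc m\<close>.\<close>

record 'v filtered_digraph =
  level :: "nat \<Rightarrow> 'v pair_pre_digraph"
  step :: "nat \<Rightarrow> 'v \<Rightarrow> 'v"

text \<open>Only the levels \<open>m \<le> n\<close>, and the embeddings between them, are considered.\<close>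

definition is_filtered_digraph :: "enat \<Rightarrow> 'v filtered_digraph \<Rightarrow> bool" where
  "is_filtered_digraph n G \<longleftrightarrow>
     (\<forall>m. enat m \<le> n \<longrightarrow> pair_wf_digraph (level G m)) \<and>
     (\<forall>m. enat (Suc m) \<le> n \<longrightarrow> digraph_embedding (level G m) (level G (Suc m)) (step G m))"

definition filtered_digraph_isomorphism ::
    "enat \<Rightarrow> 'v filtered_digraph \<Rightarrow> 'w filtered_digraph \<Rightarrow> (nat \<Rightarrow> 'v \<Rightarrow> 'w) \<Rightarrow> bool" where
  "filtered_digraph_isomorphism n G H \<tau> \<longleftrightarrow>
     is_filtered_digraph n G \<and> is_filtered_digraph n H \<and>
     (\<forall>m. enat m \<le> n \<longrightarrow> digraph_isomorphic_via (level G m) (level H m) (\<tau> m)) \<and>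
     (\<forall>m. enat (Suc m) \<le> n \<longrightarrow>
        (\<forall>v\<in>pverts (level G m). \<tau> (Suc m) (step G m v) = step H m (\<tau> m v)))"

definition adjacency_digraph :: "'a fun_space \<Rightarrow> 'a set set \<Rightarrow> 'a set pair_pre_digraph" where
  "adjacency_digraph X L = \<lparr>pverts = L,
     parcs = {(A, B). A \<in> L \<and> B \<in> L \<and> (euclidean_topology X closure_of A) \<inter> B \<noteq> {}}\<rparr>"

definition digraph_power :: "'v pair_pre_digraph \<Rightarrow> nat \<Rightarrow> (nat \<Rightarrow> 'v) pair_pre_digraph" where
  "digraph_power G m = \<lparr>pverts = {..<m} \<rightarrow>\<^sub>E pverts G,
     parcs = {(x, y). x \<in> {..<m} \<rightarrow>\<^sub>E pverts G \<and> y \<in> {..<m} \<rightarrow>\<^sub>E pverts G \<and>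
                (\<forall>i<m. (x i, y i) \<in> parcs G)}\<rparr>"

definition digraph_symmetric_power :: "'v pair_pre_digraph \<Rightarrow> nat \<Rightarrow> 'v multiset pair_pre_digraph"
  where
  "digraph_symmetric_power G m = \<lparr>pverts = multisets (pverts G) m,
     parcs = map_prod (tuple_mset m) (tuple_mset m) ` parcs (digraph_power G m)\<rparr>"

definition filtered_symmetric_power :: "'v pair_pre_digraph \<Rightarrow> 'v \<Rightarrow> 'v multiset filtered_digraph"
  where
  "filtered_symmetric_power G F =
     \<lparr>level = digraph_symmetric_power G, step = (\<lambda>m. add_mset F)\<rparr>"

text \<open>
  The adjacency digraphs of the symmetric products \<open>Y m\<close>; a stratum is sent to the stratum of
  the next level that contains its image under the embedding adding \<open>e\<close> to a multiset.
\<close>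

definition filtered_symmetric_adjacency ::
    "(nat \<Rightarrow> 'a multiset fun_space) \<Rightarrow> 'a set set \<Rightarrow> 'a \<Rightarrow> 'a multiset set filtered_digraph" where
  "filtered_symmetric_adjacency Y L e =
     \<lparr>level = (\<lambda>m. adjacency_digraph (Y m) (symmetric_strata L m)),
      step = (\<lambda>m S. THE S'. S' \<in> symmetric_strata L (Suc m) \<and> add_mset e ` S \<subseteq> S')\<rparr>"

end

theory Submission
  imports Defs "HOL-Combinatorics.Permutations"
begin

text \<open>
  Let \<open>\<pi>\<close> be the quotient map from tuples to multisets. The isomorphism sends a multiset \<open>N\<close> of
  strata to the set of those multisets of points whose multiset of strata is \<open>N\<close>. It is a
  bijection onto the strata of the symmetric product because strata are nonempty and disjoint, and
  adding \<open>e\<close> to a multiset of points adds \<open>F\<close> to its multiset of strata. All the geometry is in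
  the arcs, that is, in the closure of a symmetric stratum.

  The preimage under \<open>\<pi>\<close> of the symmetric stratum of \<open>N\<close> is the union of the boxes
  \<open>a 0 \<times> \<dots> \<times> a (m - 1)\<close> over the orderings \<open>a\<close> of \<open>N\<close>. The Euclidean topology of the power
  of a variety is the product topology (\<open>euclidean_topology_power_space\<close>), so the closure of a box
  is the box of the closures; there are finitely many orderings, because there are finitely many
  strata, so the closure of the preimage is the union of the closed boxes. This union is invariant
  under permutations of the coordinates. Since \<open>\<pi>\<close> is a topological quotient map, its image is
  therefore closed and is the closure of the symmetric stratum (\<open>closure_of_symmetric_stratum\<close>).
  So this closure meets the symmetric stratum of \<open>N'\<close> iff some orderings \<open>a\<close> of \<open>N\<close> and \<open>b\<close> of
  \<open>N'\<close> satisfy \<open>closure (a i) \<inter> b i \<noteq> {}\<close> for all \<open>i\<close>, which is the definition of an arc of the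
  symmetric power of the adjacency digraph.
\<close>

section \<open>The Euclidean topology of a power of a variety\<close>

text \<open>
  Constants are regular on the affine charts, where they are quotients of constant polynomials;
  the sheaf property extends this to all open sets. The Euclidean topology is generated by
  preimages under regular functions, so a Zariski open set is Euclidean open because it carries
  some regular function; a constant serves.
\<close>

lemma const_regular:
  assumes X: "real_algebraic_variety X" and W: "openin (zar X) W"
  shows "(\<lambda>_. c) \<in> reg X W"
proof -
  obtain \<U> where cover: "\<Union>\<U> = points X"
    and charts: "\<And>U. U \<in> \<U> \<Longrightarrow> \<exists>k V h. affine_chart X U k V h"
    using X by (auto simp: real_algebraic_variety_def)
  have chart: "openin (zar X) U \<and> (\<lambda>_. c) \<in> reg X U" if U: "U \<in> \<U>" for U
  proof -
    obtain k V h where "affine_chart X U k V h" using charts[OF U] by blast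
    then have op: "openin (zar X) U"
      and hom: "homeomorphic_map (zar (open_subspace X U)) (zar (algebraic_set_space k V)) h"
      and reg: "\<And>W f. openin (zar (algebraic_set_space k V)) W \<Longrightarrow>
        f \<in> reg (algebraic_set_space k V) W \<longleftrightarrow>
        (\<lambda>x. f (h x)) \<in> reg (open_subspace X U) {x \<in> points (open_subspace X U). h x \<in> W}"
      by (auto simp: affine_chart_def biregular_map_def)
    let ?V = "topspace (zar (algebraic_set_space k V))"
    have const: "(\<lambda>_. d) \<in> polys k" for d
      by (simp add: polys_def fun_algebra.const)
    have "(\<lambda>_. c) \<in> reg (algebraic_set_space k V) ?V"
      unfolding algebraic_set_space_def fun_space.simps
      using const by (intro CollectI ballI bexI[of _ "\<lambda>_. c"] bexI[of _ "\<lambda>_. 1"]) auto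
    then have "(\<lambda>_. c) \<in> reg (open_subspace X U) {x \<in> points (open_subspace X U). h x \<in> ?V}"
      using reg[of ?V "\<lambda>_. c"] by simp
    moreover have "{x \<in> points (open_subspace X U). h x \<in> ?V} = U"
      using homeomorphic_imp_surjective_map[OF hom] openin_subset[OF op]
      by (auto simp: points_def open_subspace_def)
    ultimately show ?thesis using op by (simp add: open_subspace_def)
  qed
  have sheaf: "sheaf_of_functions X" using X by (simp add: real_algebraic_variety_def)
  have "\<exists>V. openin (zar X) V \<and> x \<in> V \<and> V \<subseteq> W \<and> (\<lambda>_. c) \<in> reg X V" if x: "x \<in> W" for x
  proof -
    have "x \<in> points X" using openin_subset[OF W] x by (auto simp: points_def)
    then obtain U where U: "U \<in> \<U>" "x \<in> U" using cover by blast
    have op: "openin (zar X) (U \<inter> W)" using chart[OF U(1)] W by auto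
    moreover have "(\<lambda>_. c) \<in> reg X (U \<inter> W)"
      using sheaf chart[OF U(1)] op unfolding sheaf_of_functions_def by (meson inf_le1)
    ultimately show ?thesis using U x by blast
  qed
  then show ?thesis using sheaf W unfolding sheaf_of_functions_def by (metis (no_types, lifting))
qed

lemma openin_euclidean_basis:
  assumes "openin (zar X) U" "f \<in> reg X U" "open S"
  shows "openin (euclidean_topology X) {x \<in> U. f x \<in> S}"
  unfolding euclidean_topology_def by (rule topology_generated_by_Basis) (use assms in blast)

lemma zariski_open_imp_euclidean_open:
  assumes "real_algebraic_variety X" "openin (zar X) U"
  shows "openin (euclidean_topology X) U"
  using openin_euclidean_basis[OF assms(2) const_regular[OF assms, of 0] open_UNIV] by simp

lemma topspace_euclidean_topology:
  assumes "real_algebraic_variety X"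
  shows "topspace (euclidean_topology X) = points X"
proof
  show "topspace (euclidean_topology X) \<subseteq> points X"
    unfolding euclidean_topology_def points_def using openin_subset by fastforce
  show "points X \<subseteq> topspace (euclidean_topology X)"
    using openin_subset[OF zariski_open_imp_euclidean_open[OF assms openin_topspace]]
    by (simp add: points_def)
qed

lemma continuous_map_regular:
  assumes X: "real_algebraic_variety X" and U: "openin (zar X) U" and f: "f \<in> reg X U"
  shows "continuous_map (subtopology (euclidean_topology X) U) euclideanreal f"
proof -
  have sub: "U \<subseteq> topspace (euclidean_topology X)"
    using openin_subset[OF zariski_open_imp_euclidean_open[OF X U]] .
  have "openin (subtopology (euclidean_topology X) U)
          {x \<in> topspace (subtopology (euclidean_topology X) U). f x \<in> S}" if "open S" for S
  proof -
    have "{x \<in> topspace (subtopology (euclidean_topology X) U). f x \<in> S} = {x \<in> U. f x \<in> S}"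
      using sub by auto
    then show ?thesis
      using openin_euclidean_basis[OF U f that] zariski_open_imp_euclidean_open[OF X U]
      by (simp add: openin_open_subtopology)
  qed
  then show ?thesis by (auto simp: continuous_map_def)
qed

abbreviation euclidean_power :: "nat \<Rightarrow> 'a fun_space \<Rightarrow> (nat \<Rightarrow> 'a) topology" where
  "euclidean_power m X \<equiv> product_topology (\<lambda>_. euclidean_topology X) {..<m}"

lemma openin_box:
  assumes "real_algebraic_variety X" "\<forall>i<m. openin (zar X) (U i)"
  shows "openin (euclidean_power m X) (PiE {..<m} U)"
  using assms by (auto simp: openin_PiE_gen intro: zariski_open_imp_euclidean_open)

lemma continuous_map_product_funs:
  assumes X: "real_algebraic_variety X" and U: "\<forall>i<m. openin (zar X) (U i)"
    and q: "q \<in> product_funs m X U"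
  shows "continuous_map (subtopology (euclidean_power m X) (PiE {..<m} U)) euclideanreal q"
  using q unfolding product_funs_def
proof (induction rule: fun_algebra.induct)
  case (gen f)
  then obtain g i where f: "f = (\<lambda>x. g (x i))" and i: "i < m" and g: "g \<in> reg X (U i)" by blast
  have "continuous_map (subtopology (euclidean_power m X) (PiE {..<m} U))
          (subtopology (euclidean_topology X) (U i)) (\<lambda>x. x i)"
    using i by (auto simp: continuous_map_in_subtopology
        intro: continuous_map_from_subtopology continuous_map_product_projection)
  from continuous_map_compose[OF this continuous_map_regular[OF X _ g]]
  show ?case using U i by (simp add: f o_def)
qed (auto intro: continuous_map_add continuous_map_real_mult)

lemma openin_nonvanishing:
  assumes X: "real_algebraic_variety X" and U: "\<forall>i<m. openin (zar X) (U i)"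
    and q: "q \<in> product_funs m X U"
  shows "openin (euclidean_power m X) {x \<in> PiE {..<m} U. q x \<noteq> 0}"
proof -
  have "openin euclideanreal (- {0})" by (simp add: open_Compl)
  moreover have "topspace (subtopology (euclidean_power m X) (PiE {..<m} U)) = PiE {..<m} U"
    using openin_subset[OF openin_box[OF X U]] by (simp add: Int_absorb1)
  ultimately have "openin (subtopology (euclidean_power m X) (PiE {..<m} U))
      {x \<in> PiE {..<m} U. q x \<noteq> 0}"
    using openin_continuous_map_preimage[OF continuous_map_product_funs[OF X U q], of "- {0}"]
    by simp
  then show ?thesis using openin_box[OF X U] by (simp add: openin_open_subtopology)
qed

lemma box_in_power:
  assumes "\<forall>i<m. U i \<subseteq> A"
  shows "{x \<in> {..<m} \<rightarrow>\<^sub>E A. (\<forall>i<m. x i \<in> U i) \<and> P x} = {x \<in> PiE {..<m} U. P x}"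
  using assms by (auto simp: PiE_iff)

lemma openin_zar_power_space:
  assumes X: "real_algebraic_variety X" and W: "openin (zar (power_space m X)) W"
  shows "openin (euclidean_power m X) W"
proof -
  let ?B = "{{x \<in> {..<m} \<rightarrow>\<^sub>E points X. (\<forall>i<m. x i \<in> U i) \<and> q x \<noteq> 0} | U q.
             (\<forall>i<m. openin (zar X) (U i)) \<and> q \<in> product_funs m X U}"
  have "openin (euclidean_power m X) S" if SB: "S \<in> ?B" for S
  proof -
    obtain U q where S: "S = {x \<in> {..<m} \<rightarrow>\<^sub>E points X. (\<forall>i<m. x i \<in> U i) \<and> q x \<noteq> 0}"
      and U: "\<forall>i<m. openin (zar X) (U i)" and q: "q \<in> product_funs m X U"
      using SB by blast
    have "\<forall>i<m. U i \<subseteq> points X" using U openin_subset by (auto simp: points_def)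
    then have "S = {x \<in> PiE {..<m} U. q x \<noteq> 0}"
      unfolding S by (rule box_in_power)
    then show ?thesis using openin_nonvanishing[OF X U q] by simp
  qed
  moreover have "generate_topology_on ?B W"
    using W by (auto simp: power_space_def openin_topology_generated_by_iff)
  ultimately show ?thesis
    using generate_topology_on_coarsest[OF istopology_openin] by blast
qed

lemma openin_euclidean_power_space_basis:
  assumes X: "real_algebraic_variety X" and W: "openin (zar (power_space m X)) W"
    and f: "f \<in> reg (power_space m X) W" and S: "open S"
  shows "openin (euclidean_power m X) {x \<in> W. f x \<in> S}"
proof (subst openin_subopen, intro ballI)
  fix x assume "x \<in> {x \<in> W. f x \<in> S}"
  then have x: "x \<in> W" "f x \<in> S" by auto
  let ?P = "euclidean_power m X"
  obtain U p q where U: "\<forall>i<m. openin (zar X) (U i)" and xU: "\<forall>i<m. x i \<in> U i"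
    and p: "p \<in> product_funs m X U" and q: "q \<in> product_funs m X U" and qx: "q x \<noteq> 0"
    and fpq: "\<forall>y\<in>W. (\<forall>i<m. y i \<in> U i) \<longrightarrow> q y \<noteq> 0 \<longrightarrow> f y = p y / q y"
  proof -
    have "\<exists>U. (\<forall>i<m. openin (zar X) (U i) \<and> x i \<in> U i) \<and>
        (\<exists>p\<in>product_funs m X U. \<exists>q\<in>product_funs m X U. q x \<noteq> 0 \<and>
          (\<forall>y\<in>W. (\<forall>i<m. y i \<in> U i) \<longrightarrow> q y \<noteq> 0 \<longrightarrow> f y = p y / q y))"
      using f x by (simp add: power_space_def)
    then show ?thesis using that by blast
  qed
  \<comment> \<open>a neighbourhood of \<open>x\<close> on which \<open>f\<close> is a quotient of continuous functions\<close>
  define N where "N = W \<inter> {y \<in> PiE {..<m} U. q y \<noteq> 0}"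
  have WP: "openin ?P W" by (rule openin_zar_power_space[OF X W])
  have N: "openin ?P N" unfolding N_def using WP openin_nonvanishing[OF X U q] by auto
  have ext: "x \<in> extensional {..<m}"
    using openin_subset[OF WP] x by (auto simp: PiE_iff)
  have top: "topspace (subtopology ?P N) = N" using openin_subset[OF N] by (simp add: Int_absorb1)
  have cont: "continuous_map (subtopology ?P N) euclideanreal r" if "r \<in> product_funs m X U" for r
    by (rule continuous_map_from_subtopology_mono[OF continuous_map_product_funs[OF X U that]])
      (auto simp: N_def)
  have quot: "continuous_map (subtopology ?P N) euclideanreal (\<lambda>y. p y / q y)"
    by (rule continuous_map_real_divide[OF cont[OF p] cont[OF q]]) (auto simp: N_def)
  have "openin (subtopology ?P N) {y \<in> N. p y / q y \<in> S}"
    using openin_continuous_map_preimage[OF quot, of S] S unfolding top by simp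
  then have "openin ?P {y \<in> N. p y / q y \<in> S}" using N by (simp add: openin_open_subtopology)
  moreover have "{y \<in> N. p y / q y \<in> S} = {y \<in> N. f y \<in> S}"
    using fpq by (auto simp: N_def PiE_iff)
  moreover have "x \<in> N" using x xU qx ext by (auto simp: N_def PiE_iff)
  ultimately show "\<exists>T. openin ?P T \<and> x \<in> T \<and> T \<subseteq> {x \<in> W. f x \<in> S}"
    using x by (intro exI[of _ "{y \<in> N. f y \<in> S}"]) (auto simp: N_def)
qed

lemma openin_zar_power_box:
  assumes "\<forall>i<m. openin (zar X) (U i)"
  shows "openin (zar (power_space m X)) (PiE {..<m} U)"
proof -
  have "\<forall>i<m. U i \<subseteq> points X" using assms openin_subset by (auto simp: points_def)
  then have "PiE {..<m} U = {x \<in> {..<m} \<rightarrow>\<^sub>E points X. (\<forall>i<m. x i \<in> U i) \<and> (1::real) \<noteq> 0}"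
    using box_in_power[of m U "points X" "\<lambda>_. True"] by simp
  moreover have "(\<lambda>_. 1) \<in> product_funs m X U"
    by (simp add: product_funs_def fun_algebra.const)
  ultimately show ?thesis
    unfolding power_space_def fun_space.simps
    using assms by (intro topology_generated_by_Basis CollectI exI[of _ U] exI[of _ "\<lambda>_. 1"]) auto
qed

lemma product_fun_regular:
  assumes "\<forall>i<m. openin (zar X) (U i)" and "p \<in> product_funs m X U"
  shows "p \<in> reg (power_space m X) (PiE {..<m} U)"
proof -
  have one: "(\<lambda>_. 1) \<in> product_funs m X U"
    by (simp add: product_funs_def fun_algebra.const)
  show ?thesis
    unfolding power_space_def fun_space.simps
  proof (intro CollectI ballI exI[of _ U] conjI)
    fix x assume "x \<in> PiE {..<m} U"
    then show "\<forall>i<m. openin (zar X) (U i) \<and> x i \<in> U i" using assms(1) by (simp add: PiE_iff)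
    show "\<exists>p'\<in>product_funs m X U. \<exists>q\<in>product_funs m X U. q x \<noteq> 0 \<and>
        (\<forall>y\<in>PiE {..<m} U. (\<forall>i<m. y i \<in> U i) \<longrightarrow> q y \<noteq> 0 \<longrightarrow> p y = p' y / q y)"
      by (rule bexI[OF bexI[OF _ one] assms(2)]) simp
  qed
qed

text \<open>
  Regular functions on the power are locally quotients of polynomials in regular functions of the
  coordinates, hence continuous in the product topology; conversely, a regular function of a
  single coordinate is regular on a box all of whose other sides are the whole variety, so the
  projections are continuous.
\<close>

lemma euclidean_topology_power_space:
  assumes X: "real_algebraic_variety X"
  shows "euclidean_topology (power_space m X) = euclidean_power m X"
proof -
  let ?P = "euclidean_power m X" and ?E = "euclidean_topology (power_space m X)"
  have EP: "openin ?P W" if "openin ?E W" for W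
  proof (rule generate_topology_on_coarsest[OF istopology_openin])
    show "generate_topology_on
        {{x \<in> U. f x \<in> S} | U f S. openin (zar (power_space m X)) U \<and>
           f \<in> reg (power_space m X) U \<and> open S} W"
      using that unfolding euclidean_topology_def openin_topology_generated_by_iff .
  qed (auto intro: openin_euclidean_power_space_basis[OF X])
  have box: "openin ?E {x \<in> PiE {..<m} U. p x \<in> S}"
    if "\<forall>i<m. openin (zar X) (U i)" "p \<in> product_funs m X U" "open S" for U p S
    using openin_euclidean_basis[OF openin_zar_power_box product_fun_regular] that by blast
  have whole: "openin ?E ({..<m} \<rightarrow>\<^sub>E points X)"
    using box[of "\<lambda>_. points X" "\<lambda>_. 0" UNIV]
    by (simp add: points_def product_funs_def fun_algebra.const)
  have top: "topspace ?E = {..<m} \<rightarrow>\<^sub>E points X"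
    using openin_subset[OF EP[OF openin_topspace]] openin_subset[OF whole]
    by (auto simp: topspace_euclidean_topology[OF X])
  have proj: "continuous_map ?E (euclidean_topology X) (\<lambda>x. x i)" if i: "i < m" for i
    unfolding euclidean_topology_def[of X]
  proof (rule continuous_on_generated_topo)
    fix V assume "V \<in> {{x \<in> U. f x \<in> S} | U f S. openin (zar X) U \<and> f \<in> reg X U \<and> open S}"
    then obtain U f S where V: "V = {x \<in> U. f x \<in> S}" and U: "openin (zar X) U"
      and f: "f \<in> reg X U" and S: "open S" by blast
    let ?U = "\<lambda>j. if j = i then U else points X"
    have "(\<lambda>x. f (x i)) \<in> product_funs m X ?U"
      unfolding product_funs_def by (rule fun_algebra.gen) (use f i in force)
    then have "openin ?E {x \<in> PiE {..<m} ?U. f (x i) \<in> S}"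
      using U S by (intro box) (auto simp: points_def)
    moreover have "{x \<in> PiE {..<m} ?U. f (x i) \<in> S} = (\<lambda>x. x i) -` V \<inter> topspace ?E"
      using i openin_subset[OF U] by (auto simp: V top PiE_iff points_def extensional_def split: if_splits)
    ultimately show "openin ?E ((\<lambda>x. x i) -` V \<inter> topspace ?E)" by simp
  next
    have "points X = topspace (topology_generated_by
        {{x \<in> U. f x \<in> S} | U f S. openin (zar X) U \<and> f \<in> reg X U \<and> open S})"
      using topspace_euclidean_topology[OF X] by (simp add: euclidean_topology_def)
    then show "(\<lambda>x. x i) ` topspace ?E \<subseteq>
        \<Union> {{x \<in> U. f x \<in> S} | U f S. openin (zar X) U \<and> f \<in> reg X U \<and> open S}"
      using i unfolding top topology_generated_by_topspace by (auto simp: PiE_iff)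
  qed
  have id: "continuous_map ?E ?P (\<lambda>x. x)"
    using proj by (auto simp: continuous_map_componentwise top PiE_iff)
  have PE: "openin ?E W" if "openin ?P W" for W
  proof -
    have "W \<subseteq> topspace ?E"
      using openin_subset[OF that] by (simp add: top topspace_euclidean_topology[OF X])
    then have "{x \<in> topspace ?E. x \<in> W} = W" by auto
    then show ?thesis using openin_continuous_map_preimage[OF id that] by simp
  qed
  show ?thesis using EP PE by (auto simp: topology_eq)
qed

section \<open>Multisets and tuples\<close>

lemma set_tuple_mset: "set_mset (tuple_mset m x) = x ` {..<m}"
  by (simp add: tuple_mset_def)

lemma image_tuple_mset: "image_mset f (tuple_mset m x) = tuple_mset m (\<lambda>i. f (x i))"
  by (simp add: tuple_mset_def image_mset.compositionality comp_def)

lemma tuple_mset_cong: "(\<And>i. i < m \<Longrightarrow> x i = y i) \<Longrightarrow> tuple_mset m x = tuple_mset m y"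
  by (auto simp: tuple_mset_def intro!: image_mset_cong)

lemma tuple_mset_Suc: "tuple_mset (Suc m) (x(m := a)) = add_mset a (tuple_mset m x)"
proof -
  have "mset_set {..<Suc m} = add_mset m (mset_set {..<m})"
    by (simp add: lessThan_Suc)
  then show ?thesis
    by (auto simp: tuple_mset_def intro!: image_mset_cong)
qed

lemma tuple_mset_in_multisets: "x \<in> {..<m} \<rightarrow>\<^sub>E A \<Longrightarrow> tuple_mset m x \<in> multisets A m"
  by (auto simp: multisets_def set_tuple_mset PiE_iff) (simp add: tuple_mset_def)

lemma multisets_imp_tuple:
  assumes "M \<in> multisets A m"
  obtains x where "x \<in> {..<m} \<rightarrow>\<^sub>E A" "tuple_mset m x = M"
proof -
  obtain xs where xs: "mset xs = M" using ex_mset by blast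
  then have len: "length xs = m" "set xs \<subseteq> A" using assms by (auto simp: multisets_def)
  let ?x = "restrict (\<lambda>i. xs ! i) {..<m}"
  have "tuple_mset m ?x = tuple_mset m (\<lambda>i. xs ! i)" by (rule tuple_mset_cong) simp
  also have "\<dots> = mset (map (\<lambda>i. xs ! i) [0..<m])"
    by (simp add: tuple_mset_def atLeast0LessThan)
  also have "\<dots> = M" using xs len by (metis map_nth)
  finally show ?thesis using len by (intro that[of ?x]) auto
qed

lemma tuple_mset_eq_imp_permuted:
  assumes "tuple_mset m x = tuple_mset m y"
  obtains \<sigma> where "\<sigma> permutes {..<m}" "\<And>i. i < m \<Longrightarrow> x i = y (\<sigma> i)"
proof (rule image_mset_eq_implies_permutes[of "{..<m}" x y])
  show "image_mset x (mset_set {..<m}) = image_mset y (mset_set {..<m})"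
    using assms by (simp add: tuple_mset_def)
qed (auto intro: that)

lemma tuple_mset_permute:
  assumes "\<sigma> permutes {..<m}"
  shows "tuple_mset m (\<lambda>i. x (\<sigma> i)) = tuple_mset m x"
proof -
  have "image_mset \<sigma> (mset_set {..<m}) = mset_set {..<m}"
    using assms by (simp add: image_mset_mset_set permutes_inj_on permutes_image)
  then show ?thesis
    by (metis (no_types, lifting) comp_def image_mset.compositionality multiset.map_cong0 tuple_mset_def)
qed

section \<open>Strata of symmetric products\<close>

definition part_of :: "'a set set \<Rightarrow> 'a \<Rightarrow> 'a set" where
  "part_of L x = (THE A. A \<in> L \<and> x \<in> A)"

text \<open>
  A stratum of the symmetric product, indexed by the vertex of the symmetric power of the adjacency
  digraph to which it corresponds. This is the vertex map of the isomorphism.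
\<close>

definition symmetric_stratum :: "'a set set \<Rightarrow> nat \<Rightarrow> 'a set multiset \<Rightarrow> 'a multiset set" where
  "symmetric_stratum L m N = {M \<in> multisets (\<Union>L) m. image_mset (part_of L) M = N}"

lemma part_of_eq:
  assumes "disjoint L" "A \<in> L" "x \<in> A"
  shows "part_of L x = A"
  unfolding part_of_def
proof (rule the_equality)
  fix B assume "B \<in> L \<and> x \<in> B"
  then show "B = A" using disjointD[OF assms(1), of B A] assms(2,3) by blast
qed (use assms in simp)

lemma part_of_in:
  assumes "disjoint L" "x \<in> \<Union>L"
  shows "part_of L x \<in> L" "x \<in> part_of L x"
proof -
  obtain A where A: "A \<in> L" "x \<in> A" using assms(2) by blast
  show "part_of L x \<in> L" "x \<in> part_of L x" using A part_of_eq[OF assms(1) A] by simp_all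
qed

lemma count_image_part_of:
  assumes L: "disjoint L" and M: "set_mset M \<subseteq> \<Union>L" and A: "A \<in> L"
  shows "count (image_mset (part_of L) M) A = size {#x \<in># M. x \<in> A#}"
proof -
  have "{#x \<in># M. A = part_of L x#} = {#x \<in># M. x \<in> A#}"
  proof (rule filter_mset_cong)
    fix x assume "x \<in># M"
    then have "x \<in> \<Union>L" using M by blast
    then show "A = part_of L x \<longleftrightarrow> x \<in> A"
      using part_of_eq[OF L A] part_of_in(2)[OF L] by blast
  qed simp
  moreover have "count (image_mset (part_of L) M) A = size {#x \<in># M. A = part_of L x#}"
    by (induction M) auto
  ultimately show ?thesis by simp
qed

lemma image_part_of_in_multisets:
  assumes "disjoint L" "M \<in> multisets (\<Union>L) m"
  shows "image_mset (part_of L) M \<in> multisets L m"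
proof -
  have "set_mset M \<subseteq> \<Union>L" "size M = m" using assms(2) by (simp_all add: multisets_def)
  then have "image_mset (part_of L) M \<in> {N. set_mset N \<subseteq> L \<and> size N = m}"
    using part_of_in(1)[OF assms(1)] by (auto simp: subset_iff)
  then show ?thesis by (simp add: multisets_def)
qed

lemma symmetric_stratum_nonempty:
  assumes L: "disjoint L" "{} \<notin> L" and N: "N \<in> multisets L m"
  shows "symmetric_stratum L m N \<noteq> {}"
proof -
  \<comment> \<open>replace every stratum in \<open>N\<close> by one of its points\<close>
  let ?pt = "\<lambda>A. SOME x. x \<in> A"
  have pt: "?pt A \<in> A" if "A \<in> L" for A
    using that L(2) by (metis ex_in_conv someI_ex)
  have NL: "set_mset N \<subseteq> L" and size: "size N = m" using N by (auto simp: multisets_def)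
  have "image_mset (part_of L) (image_mset ?pt N) = image_mset (\<lambda>A. part_of L (?pt A)) N"
    by (simp add: image_mset.compositionality comp_def)
  also have "\<dots> = image_mset (\<lambda>A. A) N"
    using NL pt part_of_eq[OF L(1)] by (intro image_mset_cong) blast
  finally have "image_mset ?pt N \<in> symmetric_stratum L m N"
    using NL size pt by (auto simp: symmetric_stratum_def multisets_def)
  then show ?thesis by blast
qed

lemma inj_on_symmetric_stratum:
  assumes "disjoint L" "{} \<notin> L"
  shows "inj_on (symmetric_stratum L m) (multisets L m)"
proof (rule inj_onI)
  fix N N' assume "N \<in> multisets L m" and eq: "symmetric_stratum L m N = symmetric_stratum L m N'"
  then obtain M where "M \<in> symmetric_stratum L m N"
    using symmetric_stratum_nonempty[OF assms] by blast
  with eq show "N = N'" by (auto simp: symmetric_stratum_def)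
qed

lemma symmetric_stratum_eq_counts:
  assumes L: "disjoint L" and N: "N \<in> multisets L m"
  shows "symmetric_stratum L m N =
    {M \<in> multisets (\<Union>L) m. \<forall>A\<in>L. size {#x \<in># M. x \<in> A#} = count N A}"
proof -
  have "image_mset (part_of L) M = N \<longleftrightarrow> (\<forall>A\<in>L. size {#x \<in># M. x \<in> A#} = count N A)"
    if M: "M \<in> multisets (\<Union>L) m" for M
  proof -
    have sub: "set_mset M \<subseteq> \<Union>L" using M by (simp add: multisets_def)
    have "count (image_mset (part_of L) M) A = count N A" if "A \<notin> L" for A
      using that image_part_of_in_multisets[OF L M] N
      by (metis (no_types, lifting) multisets_def mem_Collect_eq not_in_iff subsetD)
    then show ?thesis using count_image_part_of[OF L sub] by (metis multiset_eq_iff)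
  qed
  then show ?thesis by (auto simp: symmetric_stratum_def)
qed

text \<open>
  Prescribing \<open>c A\<close> points in each \<open>A\<close> amounts to prescribing the multiset of strata that contains
  each \<open>A\<close> with multiplicity \<open>c A\<close>, so the strata of the symmetric product are indexed by
  multisets of strata.
\<close>

lemma symmetric_strata_eq:
  assumes L: "disjoint L" "finite L"
  shows "symmetric_strata L m = symmetric_stratum L m ` multisets L m"
proof (intro equalityI subsetI)
  fix S assume "S \<in> symmetric_strata L m"
  then obtain c where c: "(\<Sum>A\<in>L. c A) = m"
    and S: "S = {M \<in> multisets (\<Union>L) m. \<forall>A\<in>L. size {#x \<in># M. x \<in> A#} = c A}"
    by (auto simp: symmetric_strata_def)
  define N where "N = (\<Sum>A\<in>L. replicate_mset (c A) A)"
  have count: "count N A = c A" if "A \<in> L" for A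
    using that L(2) by (simp add: N_def count_sum)
  have "set_mset N \<subseteq> L"
    using L(2) by (auto simp: N_def set_mset_sum split: if_splits)
  moreover have "size N = m"
    using c by (simp add: N_def size_multiset_sum)
  ultimately have N: "N \<in> multisets L m" by (simp add: multisets_def)
  then have "S = symmetric_stratum L m N"
    using count by (simp add: S symmetric_stratum_eq_counts[OF L(1)])
  with N show "S \<in> symmetric_stratum L m ` multisets L m" by blast
next
  fix S assume "S \<in> symmetric_stratum L m ` multisets L m"
  then obtain N where N: "N \<in> multisets L m" and S: "S = symmetric_stratum L m N" by blast
  have "(\<Sum>A\<in>L. count N A) = size N"
    unfolding size_multiset_overloaded_eq using L(2) N
    by (intro sum.mono_neutral_right) (auto simp: multisets_def not_in_iff)
  then show "S \<in> symmetric_strata L m"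
    using N unfolding symmetric_strata_def S symmetric_stratum_eq_counts[OF L(1) N]
    by (auto simp: multisets_def intro!: exI[of _ "count N"])
qed

lemma box_in_symmetric_stratum:
  assumes L: "disjoint L" and a: "a \<in> {..<m} \<rightarrow>\<^sub>E L" and x: "x \<in> PiE {..<m} a"
  shows "tuple_mset m x \<in> symmetric_stratum L m (tuple_mset m a)"
proof -
  have "tuple_mset m (\<lambda>i. part_of L (x i)) = tuple_mset m a"
    using a x part_of_eq[OF L] by (intro tuple_mset_cong) (auto simp: PiE_iff)
  moreover have "x \<in> {..<m} \<rightarrow>\<^sub>E \<Union>L" using a x by (auto simp: PiE_iff)
  ultimately show ?thesis
    by (simp add: symmetric_stratum_def image_tuple_mset tuple_mset_in_multisets)
qed

lemma symmetric_stratum_tuple: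
  assumes L: "disjoint L" and x: "x \<in> extensional {..<m}"
    and "tuple_mset m x \<in> symmetric_stratum L m N"
  obtains a where "a \<in> {..<m} \<rightarrow>\<^sub>E L" "tuple_mset m a = N" "x \<in> PiE {..<m} a"
proof -
  let ?a = "restrict (\<lambda>i. part_of L (x i)) {..<m}"
  have xL: "x i \<in> \<Union>L" if "i < m" for i
    using assms(3) that by (auto simp: symmetric_stratum_def multisets_def set_tuple_mset)
  have "tuple_mset m ?a = tuple_mset m (\<lambda>i. part_of L (x i))" by (rule tuple_mset_cong) simp
  also have "\<dots> = N" using assms(3) by (simp add: symmetric_stratum_def image_tuple_mset)
  finally show ?thesis
    using x xL part_of_in[OF L] by (intro that[of ?a]) (auto simp: PiE_iff)
qed

definition orderings :: "'b set \<Rightarrow> nat \<Rightarrow> 'b multiset \<Rightarrow> (nat \<Rightarrow> 'b) set" where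
  "orderings A m N = {a \<in> {..<m} \<rightarrow>\<^sub>E A. tuple_mset m a = N}"

lemma symmetric_stratum_eq_boxes:
  assumes L: "disjoint L"
  shows "symmetric_stratum L m N = tuple_mset m ` (\<Union>a\<in>orderings L m N. PiE {..<m} a)"
proof (intro equalityI subsetI)
  fix M assume M: "M \<in> symmetric_stratum L m N"
  then obtain x where x: "x \<in> {..<m} \<rightarrow>\<^sub>E \<Union>L" "tuple_mset m x = M"
    by (auto simp: symmetric_stratum_def elim: multisets_imp_tuple)
  then obtain a where "a \<in> {..<m} \<rightarrow>\<^sub>E L" "tuple_mset m a = N" "x \<in> PiE {..<m} a"
    using M by (auto simp: PiE_iff intro: symmetric_stratum_tuple[OF L, of x m N])
  then show "M \<in> tuple_mset m ` (\<Union>a\<in>orderings L m N. PiE {..<m} a)"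
    using x by (auto simp: orderings_def)
qed (auto simp: orderings_def dest: box_in_symmetric_stratum[OF L])

section \<open>Closures of symmetric strata\<close>

lemma quotient_map_closure_of_saturated:
  assumes f: "quotient_map X Y f"
    and sat: "{x \<in> topspace X. f x \<in> f ` (X closure_of S)} \<subseteq> X closure_of S"
    and S: "S \<subseteq> topspace X"
  shows "Y closure_of (f ` S) = f ` (X closure_of S)"
proof
  have "closedin Y (f ` (X closure_of S))"
    using f sat unfolding quotient_map_saturated_closed by simp
  then show "Y closure_of (f ` S) \<subseteq> f ` (X closure_of S)"
    using closure_of_subset[OF S] by (intro closure_of_minimal image_mono)
  show "f ` (X closure_of S) \<subseteq> Y closure_of (f ` S)"
    using continuous_map_image_closure_subset[OF quotient_imp_continuous_map[OF f]] .
qed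

text \<open>
  Closed boxes are permuted by permutations of the coordinates, and a box over an ordering of \<open>N\<close>
  becomes a box over another ordering of \<open>N\<close>. So the union of the closed boxes is saturated, which
  is what a quotient map needs to send closures to closures.
\<close>

lemma closure_of_symmetric_stratum:
  assumes X: "real_algebraic_variety X" and Y: "symmetric_product_variety m X Y"
    and L: "partition_on (points X) L" "finite L"
  shows "euclidean_topology Y closure_of (symmetric_stratum L m N) =
    tuple_mset m `
      (\<Union>a\<in>orderings L m N. \<Pi>\<^sub>E i\<in>{..<m}. euclidean_topology X closure_of (a i))"
proof -
  let ?cl = "\<lambda>A. euclidean_topology X closure_of A"
  let ?P = "euclidean_power m X"
  let ?S = "\<Union>a\<in>orderings L m N. PiE {..<m} a"
  let ?C = "\<Union>a\<in>orderings L m N. \<Pi>\<^sub>E i\<in>{..<m}. ?cl (a i)"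
  have dis: "disjoint L" and union: "\<Union>L = points X"
    using L(1) partition_onD1 partition_onD2 by blast+
  have quot: "quotient_map ?P (euclidean_topology Y) (tuple_mset m)"
    using Y by (simp add: symmetric_product_variety_def euclidean_topology_power_space[OF X])
  have "finite (orderings L m N)"
    by (rule finite_subset[OF _ finite_PiE[of "{..<m}" "\<lambda>_. L"]])
      (use L(2) in \<open>auto simp: orderings_def\<close>)
  then have cl: "?P closure_of ?S = ?C"
    by (simp add: closure_of_Union image_image closure_of_product_topology)
  have S: "?S \<subseteq> topspace ?P"
  proof (rule UN_least)
    fix a assume "a \<in> orderings L m N"
    then have "a i \<subseteq> points X" if "i < m" for i
      using union that by (auto simp: orderings_def PiE_iff)
    then show "PiE {..<m} a \<subseteq> topspace ?P"
      by (auto simp: topspace_euclidean_topology[OF X] intro!: PiE_mono)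
  qed
  have "y \<in> ?C" if y: "y \<in> topspace ?P" "tuple_mset m y \<in> tuple_mset m ` ?C" for y
  proof -
    obtain x a where a: "a \<in> orderings L m N" and x: "x \<in> (\<Pi>\<^sub>E i\<in>{..<m}. ?cl (a i))"
      and eq: "tuple_mset m y = tuple_mset m x" using y(2) by blast
    obtain \<sigma> where \<sigma>: "\<sigma> permutes {..<m}" "\<And>i. i < m \<Longrightarrow> y i = x (\<sigma> i)"
      using tuple_mset_eq_imp_permuted[OF eq] by blast
    let ?b = "restrict (\<lambda>i. a (\<sigma> i)) {..<m}"
    have \<sigma>m: "\<sigma> i < m" if "i < m" for i using permutes_in_image[OF \<sigma>(1), of i] that by simp
    have "tuple_mset m ?b = tuple_mset m (\<lambda>i. a (\<sigma> i))" by (rule tuple_mset_cong) simp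
    also have "\<dots> = N" using a tuple_mset_permute[OF \<sigma>(1), of a] by (simp add: orderings_def)
    finally have "?b \<in> orderings L m N" using a \<sigma>m by (auto simp: orderings_def PiE_iff)
    moreover have "y \<in> (\<Pi>\<^sub>E i\<in>{..<m}. ?cl (?b i))"
      using x y(1) \<sigma>(2) \<sigma>m by (auto simp: PiE_iff)
    ultimately show ?thesis by blast
  qed
  then have "{y \<in> topspace ?P. tuple_mset m y \<in> tuple_mset m ` (?P closure_of ?S)}
      \<subseteq> ?P closure_of ?S"
    unfolding cl by blast
  from quotient_map_closure_of_saturated[OF quot this S]
  show ?thesis unfolding cl symmetric_stratum_eq_boxes[OF dis] .
qed

lemma symmetric_power_arc:
  assumes "(a, b) \<in> parcs (digraph_power G m)"
  shows "(tuple_mset m a, tuple_mset m b) \<in> parcs (digraph_symmetric_power G m)"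
  using imageI[OF assms, of "map_prod (tuple_mset m) (tuple_mset m)"]
  by (simp add: digraph_symmetric_power_def)

lemma symmetric_power_arc_iff:
  assumes X: "real_algebraic_variety X" and Y: "symmetric_product_variety m X Y"
    and L: "partition_on (points X) L" "finite L"
  shows "(N, N') \<in> parcs (digraph_symmetric_power (adjacency_digraph X L) m) \<longleftrightarrow>
    euclidean_topology Y closure_of (symmetric_stratum L m N) \<inter> symmetric_stratum L m N' \<noteq> {}"
    (is "?arc \<longleftrightarrow> ?meet")
proof -
  let ?cl = "\<lambda>A. euclidean_topology X closure_of A"
  have dis: "disjoint L" using L(1) partition_onD2 by blast
  have arc: "?arc \<longleftrightarrow>
      (\<exists>a\<in>orderings L m N. \<exists>b\<in>orderings L m N'. \<forall>i<m. ?cl (a i) \<inter> b i \<noteq> {})"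
  proof
    assume ?arc
    then obtain a b where "(a, b) \<in> parcs (digraph_power (adjacency_digraph X L) m)"
      and "N = tuple_mset m a" "N' = tuple_mset m b"
      by (auto simp: digraph_symmetric_power_def)
    then show "\<exists>a\<in>orderings L m N. \<exists>b\<in>orderings L m N'. \<forall>i<m. ?cl (a i) \<inter> b i \<noteq> {}"
      by (intro bexI[of _ a] bexI[of _ b])
        (simp_all add: digraph_power_def adjacency_digraph_def orderings_def)
  next
    assume "\<exists>a\<in>orderings L m N. \<exists>b\<in>orderings L m N'. \<forall>i<m. ?cl (a i) \<inter> b i \<noteq> {}"
    then obtain a b where ab: "a \<in> orderings L m N" "b \<in> orderings L m N'"
      and meet: "\<forall>i<m. ?cl (a i) \<inter> b i \<noteq> {}" by blast
    then have "(a, b) \<in> parcs (digraph_power (adjacency_digraph X L) m)"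
      by (auto simp: digraph_power_def adjacency_digraph_def orderings_def PiE_iff)
    from symmetric_power_arc[OF this] show ?arc using ab by (simp add: orderings_def)
  qed
  show ?thesis unfolding arc closure_of_symmetric_stratum[OF X Y L]
  proof
    assume "\<exists>a\<in>orderings L m N. \<exists>b\<in>orderings L m N'. \<forall>i<m. ?cl (a i) \<inter> b i \<noteq> {}"
    then obtain a b where a: "a \<in> orderings L m N" and b: "b \<in> orderings L m N'"
      and "\<forall>i<m. \<exists>p. p \<in> ?cl (a i) \<inter> b i" by blast
    then obtain x where x: "\<forall>i<m. x i \<in> ?cl (a i) \<inter> b i" by metis
    let ?x = "restrict x {..<m}"
    have xb: "?x \<in> PiE {..<m} b" and xa: "?x \<in> (\<Pi>\<^sub>E i\<in>{..<m}. ?cl (a i))"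
      using x by auto
    have "tuple_mset m ?x \<in> symmetric_stratum L m N'"
      using b box_in_symmetric_stratum[OF dis _ xb] by (auto simp: orderings_def)
    then show "tuple_mset m ` (\<Union>a\<in>orderings L m N. \<Pi>\<^sub>E i\<in>{..<m}. ?cl (a i)) \<inter>
        symmetric_stratum L m N' \<noteq> {}"
      using a xa by blast
  next
    assume "tuple_mset m ` (\<Union>a\<in>orderings L m N. \<Pi>\<^sub>E i\<in>{..<m}. ?cl (a i)) \<inter>
        symmetric_stratum L m N' \<noteq> {}"
    then obtain a x where a: "a \<in> orderings L m N" and x: "x \<in> (\<Pi>\<^sub>E i\<in>{..<m}. ?cl (a i))"
      and "tuple_mset m x \<in> symmetric_stratum L m N'" by blast
    then obtain b where "b \<in> {..<m} \<rightarrow>\<^sub>E L" "tuple_mset m b = N'" "x \<in> PiE {..<m} b"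
      by (auto simp: PiE_iff intro: symmetric_stratum_tuple[OF dis, of x m N'])
    then show "\<exists>a\<in>orderings L m N. \<exists>b\<in>orderings L m N'. \<forall>i<m. ?cl (a i) \<inter> b i \<noteq> {}"
      using a x by (intro bexI[of _ a] bexI[of _ b]) (auto simp: orderings_def PiE_iff)
  qed
qed

section \<open>Isomorphisms of filtered digraphs\<close>

lemma digraph_isomorphic_via_iff:
  "digraph_isomorphic_via G H h \<longleftrightarrow> pair_wf_digraph G \<and> inj_on h (pverts G) \<and>
     pverts H = h ` pverts G \<and> parcs H = map_prod h h ` parcs G"
proof -
  have "inj_on (map_prod h h) (parcs G)" if G: "pair_wf_digraph G" and h: "inj_on h (pverts G)"
  proof -
    have "parcs G \<subseteq> pverts G \<times> pverts G" using pair_wf_digraph.in_arcsD1[OF G]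
        pair_wf_digraph.in_arcsD2[OF G] by auto
    then show ?thesis using map_prod_inj_on[OF h h] inj_on_subset by blast
  qed
  moreover have "digraph_isomorphic_via G H h \<longleftrightarrow> pair_wf_digraph G \<and> inj_on h (pverts G) \<and>
      inj_on (map_prod h h) (parcs G) \<and> pverts H = h ` pverts G \<and>
      parcs H = map_prod h h ` parcs G"
    unfolding wf_digraph_wp_iff[symmetric]
    by (auto simp: digraph_isomorphic_via_def pre_digraph.digraph_isomorphism_def app_iso_def
        with_proj_def)
  ultimately show ?thesis by blast
qed

text \<open>
  A filtration is transported along isomorphisms of the levels that commute with the steps, so only
  one of the two sides has to be shown to be a filtered digraph. For the symmetric products this
  means that the closure of a symmetric stratum need not be compared between two levels.
\<close>

lemma filtered_digraph_isomorphismI: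
  assumes G: "is_filtered_digraph n G"
    and iso: "\<And>m. enat m \<le> n \<Longrightarrow> digraph_isomorphic_via (level G m) (level H m) (\<tau> m)"
    and comm: "\<And>m v. enat (Suc m) \<le> n \<Longrightarrow> v \<in> pverts (level G m) \<Longrightarrow>
      \<tau> (Suc m) (step G m v) = step H m (\<tau> m v)"
  shows "filtered_digraph_isomorphism n G H \<tau>"
proof -
  have "pair_wf_digraph (level H m)" if "enat m \<le> n" for m
  proof -
    have wf: "pair_wf_digraph (level G m)"
      and H: "pverts (level H m) = \<tau> m ` pverts (level G m)"
        "parcs (level H m) = map_prod (\<tau> m) (\<tau> m) ` parcs (level G m)"
      using iso[OF that] by (simp_all add: digraph_isomorphic_via_iff)
    show ?thesis
      using pair_wf_digraph.in_arcsD1[OF wf] pair_wf_digraph.in_arcsD2[OF wf]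
      by (auto intro!: pair_wf_digraph.intro simp: H)
  qed
  moreover have "digraph_embedding (level H m) (level H (Suc m)) (step H m)"
    if m: "enat (Suc m) \<le> n" for m
  proof -
    have "enat m \<le> n" using m by (meson enat_ord_simps(1) le_SucI le_refl order_trans)
    note iso = iso[OF this] iso[OF m]
    have G: "digraph_embedding (level G m) (level G (Suc m)) (step G m)"
      using G m by (simp add: is_filtered_digraph_def)
    have inj: "inj_on (\<tau> (Suc m) \<circ> step G m) (pverts (level G m))"
      using G iso(2) by (auto simp: digraph_embedding_def digraph_isomorphic_via_iff
          intro: comp_inj_on inj_on_subset)
    have "inj_on (step H m) (\<tau> m ` pverts (level G m))"
    proof (rule inj_on_imageI)
      show "inj_on (step H m \<circ> \<tau> m) (pverts (level G m))"
        using inj comm[OF m] by (simp add: inj_on_def)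
    qed
    moreover have "step H m ` \<tau> m ` pverts (level G m) \<subseteq> \<tau> (Suc m) ` pverts (level G (Suc m))"
      using G comm[OF m, symmetric] by (auto simp: digraph_embedding_def)
    moreover have "(step H m (\<tau> m u), step H m (\<tau> m v)) \<in> parcs (level H (Suc m))"
      if uv: "(u, v) \<in> parcs (level G m)" for u v
    proof -
      have "u \<in> pverts (level G m)" "v \<in> pverts (level G m)"
        using uv iso(1) by (auto simp: digraph_isomorphic_via_iff
            dest: pair_wf_digraph.in_arcsD1 pair_wf_digraph.in_arcsD2)
      moreover have "(step G m u, step G m v) \<in> parcs (level G (Suc m))"
        using G uv by (auto simp: digraph_embedding_def)
      ultimately show ?thesis
        using iso(2) comm[OF m, symmetric] by (auto simp: digraph_isomorphic_via_iff)
    qed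
    ultimately show ?thesis
      using iso by (auto simp: digraph_embedding_def digraph_isomorphic_via_iff)
  qed
  ultimately show ?thesis
    using assms by (simp add: filtered_digraph_isomorphism_def is_filtered_digraph_def)
qed

lemma pair_wf_digraph_symmetric_power: "pair_wf_digraph (digraph_symmetric_power G m)"
  by (rule pair_wf_digraph.intro)
    (auto simp: digraph_symmetric_power_def digraph_power_def intro: tuple_mset_in_multisets)

text \<open>
  Adding \<open>F\<close> to both ends of an arc appends the pair \<open>(F, F)\<close> to a matching of the ends, so the
  loop at \<open>F\<close> is what makes this an embedding.
\<close>

lemma is_filtered_symmetric_power:
  assumes F: "F \<in> pverts G" and loop: "(F, F) \<in> parcs G"
  shows "is_filtered_digraph n (filtered_symmetric_power G F)"
proof -
  have "(add_mset F N, add_mset F N') \<in> parcs (digraph_symmetric_power G (Suc m))"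
    if NN': "(N, N') \<in> parcs (digraph_symmetric_power G m)" for N N' m
  proof -
    obtain x y where xy: "(x, y) \<in> parcs (digraph_power G m)"
      and N: "N = tuple_mset m x" "N' = tuple_mset m y"
      using NN' by (auto simp: digraph_symmetric_power_def)
    have "(x(m := F), y(m := F)) \<in> parcs (digraph_power G (Suc m))"
      using xy F loop by (auto simp: digraph_power_def PiE_iff extensional_def less_Suc_eq)
    from symmetric_power_arc[OF this] show ?thesis by (simp add: N tuple_mset_Suc)
  qed
  then have "digraph_embedding (digraph_symmetric_power G m) (digraph_symmetric_power G (Suc m))
      (add_mset F)" for m
    using F unfolding digraph_embedding_def
    by (auto simp: digraph_symmetric_power_def[of G, THEN arg_cong[where f = pverts]]
        multisets_def inj_on_def)
  then show ?thesis
    by (simp add: is_filtered_digraph_def filtered_symmetric_power_def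
        pair_wf_digraph_symmetric_power)
qed

lemma symmetric_power_isomorphic_adjacency:
  assumes X: "real_algebraic_variety X" and Y: "symmetric_product_variety m X Y"
    and L: "partition_on (points X) L" "finite L"
  shows "digraph_isomorphic_via (digraph_symmetric_power (adjacency_digraph X L) m)
    (adjacency_digraph Y (symmetric_strata L m)) (symmetric_stratum L m)"
proof -
  let ?G = "digraph_symmetric_power (adjacency_digraph X L) m"
  have dis: "disjoint L" "{} \<notin> L" using L(1) partition_onD2 partition_onD3 by blast+
  have verts: "pverts ?G = multisets L m"
    by (simp add: digraph_symmetric_power_def adjacency_digraph_def)
  have "parcs ?G \<subseteq> multisets L m \<times> multisets L m"
    using pair_wf_digraph.in_arcsD1[OF pair_wf_digraph_symmetric_power]
      pair_wf_digraph.in_arcsD2[OF pair_wf_digraph_symmetric_power] verts by fastforce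
  then have "parcs (adjacency_digraph Y (symmetric_strata L m)) =
      map_prod (symmetric_stratum L m) (symmetric_stratum L m) ` parcs ?G"
    using symmetric_power_arc_iff[OF X Y L]
    by (fastforce simp: adjacency_digraph_def symmetric_strata_eq[OF dis(1) L(2)] image_iff)
  then show ?thesis
    using inj_on_symmetric_stratum[OF dis] pair_wf_digraph_symmetric_power verts
    by (simp add: digraph_isomorphic_via_iff adjacency_digraph_def
        symmetric_strata_eq[OF dis(1) L(2)])
qed

text \<open>
  A symmetric stratum is determined by any one of its points, which is why only one can contain the
  image of the nonempty stratum of \<open>N\<close>.
\<close>

lemma symmetric_stratum_step:
  assumes L: "disjoint L" "{} \<notin> L" "finite L" and F: "F \<in> L" "e \<in> F"
    and N: "N \<in> multisets L m"
  shows "(THE S'. S' \<in> symmetric_strata L (Suc m) \<and>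
      add_mset e ` symmetric_stratum L m N \<subseteq> S') = symmetric_stratum L (Suc m) (add_mset F N)"
proof (rule the_equality)
  have "part_of L e = F" "e \<in> \<Union>L" using part_of_eq[OF L(1) F] F by auto
  then have sub: "add_mset e ` symmetric_stratum L m N \<subseteq> symmetric_stratum L (Suc m) (add_mset F N)"
    by (auto simp: symmetric_stratum_def multisets_def simp del: Union_iff)
  then show "symmetric_stratum L (Suc m) (add_mset F N) \<in> symmetric_strata L (Suc m) \<and>
      add_mset e ` symmetric_stratum L m N \<subseteq> symmetric_stratum L (Suc m) (add_mset F N)"
    using N F by (auto simp: symmetric_strata_eq[OF L(1,3)] multisets_def)
  fix S' assume S': "S' \<in> symmetric_strata L (Suc m) \<and> add_mset e ` symmetric_stratum L m N \<subseteq> S'"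
  then obtain N' where N': "S' = symmetric_stratum L (Suc m) N'"
    by (auto simp: symmetric_strata_eq[OF L(1,3)])
  obtain M where "M \<in> symmetric_stratum L m N"
    using symmetric_stratum_nonempty[OF L(1,2) N] by blast
  then have "add_mset e M \<in> symmetric_stratum L (Suc m) N'"
    "add_mset e M \<in> symmetric_stratum L (Suc m) (add_mset F N)"
    using S' N' sub by auto
  then show "S' = symmetric_stratum L (Suc m) (add_mset F N)"
    unfolding N' by (auto simp: symmetric_stratum_def)
qed

theorem proposition13:
  fixes T :: "'a fun_space" and L :: "'a set set" and e :: 'a and F :: "'a set"
    and n :: enat and Tsym :: "nat \<Rightarrow> 'a multiset fun_space"
  assumes "stratified_variety T L"
    and "finite L"
    and "F \<in> L" and "e \<in> F"
    and "\<And>m. enat m \<le> n \<Longrightarrow> symmetric_product_variety m T (Tsym m)"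
  shows "\<exists>\<tau>. filtered_digraph_isomorphism n
           (filtered_symmetric_power (adjacency_digraph T L) F)
           (filtered_symmetric_adjacency Tsym L e) \<tau>"
proof -
  have T: "real_algebraic_variety T" and part: "partition_on (points T) L"
    using assms(1) by (auto simp: stratified_variety_def)
  have L: "disjoint L" "{} \<notin> L" and union: "\<Union>L = points T"
    using part partition_onD1 partition_onD2 partition_onD3 by blast+
  have "F \<subseteq> euclidean_topology T closure_of F"
    using assms(3) union by (intro closure_of_subset) (auto simp: topspace_euclidean_topology[OF T])
  then have "(F, F) \<in> parcs (adjacency_digraph T L)"
    using assms(3,4) by (auto simp: adjacency_digraph_def)
  moreover have "F \<in> pverts (adjacency_digraph T L)"
    using assms(3) by (simp add: adjacency_digraph_def)
  ultimately have "is_filtered_digraph n (filtered_symmetric_power (adjacency_digraph T L) F)"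
    by (simp add: is_filtered_symmetric_power)
  moreover have "symmetric_stratum L (Suc m) (add_mset F N) =
      step (filtered_symmetric_adjacency Tsym L e) m (symmetric_stratum L m N)"
    if "N \<in> pverts (digraph_symmetric_power (adjacency_digraph T L) m)" for m N
    using that symmetric_stratum_step[OF L assms(2-4)]
    by (simp add: filtered_symmetric_adjacency_def digraph_symmetric_power_def
        adjacency_digraph_def)
  ultimately have "filtered_digraph_isomorphism n
      (filtered_symmetric_power (adjacency_digraph T L) F)
      (filtered_symmetric_adjacency Tsym L e) (symmetric_stratum L)"
    using symmetric_power_isomorphic_adjacency[OF T assms(5) part assms(2)]
    by (intro filtered_digraph_isomorphismI)
      (simp_all add: filtered_symmetric_power_def filtered_symmetric_adjacency_def)
  then show ?thesis by blast
qed

end
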